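(* Let $\mathcal{P}$ be a finite locally branched lattice given as a meet semi-sublattice of the boolean lattice $B_n$, let $I$ be a list of subsets of $\{1,\dots,n\}$, let $J\subseteq\{1,\dots,n\}$, and let $C$ be the list of coatoms of $\mathcal{P}$ not contained in any element of $I$. Let $r+1$ be the number of elements in a longest chain of $\mathcal{P}$, let $m=|C|$, let $$\alpha=\sum_{a\in C\cup I}|a\cup J|,$$ and let $\varphi$ be the number of recursive calls of FaceIterator made when it is run with input $(C,I,J)$. Then, in the cost model described in the context, the algorithm FaceIterator run with input $(C,I,J)$ has memory consumption $\mathcal{O}(\alpha\cdot r)$ and runtime $\mathcal{O}(\alpha\cdot m\cdot\varphi)$.
   Context: A finite lattice is locally branched if for every saturated chain $a\prec b\prec c$ there is an element $d\neq b$ with $a<d<c$. $B_n$ is the lattice of all subsets of $\{1,\dots,n\}$ ordered by inclusion. That $\mathcal{P}$ is given as a meet semi-sublattice of $B_n$ means: the atoms of $\mathcal{P}$ are $\{1\},\dots,\{n\}$ (identified with $1,\dots,n$), each element is identified with the set of atoms below it, the order is inclusion, and meets are intersections. Coatoms are the lower covers of the upper bound $\hat 1$. Algorithm FaceIterator$(C,I,J)$, where $C$ is a list (without repetitions) of subsets of $\{1,\dots,n\}$, $I$ is a list of subsets of $\{1,\dots,n\}$ (ignored sets), and $J\subseteq\{1,\dots,n\}$ (ignored atoms). If $C$ is empty, stop. Otherwise: 1. Let $a$ be the first element of $C$. 2. If $a\cap J=\emptyset$, output $a$. 3. Let $N_1=\{a\cap b : b\in C,\ b\neq a\}$, let $N_2=\{x\in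 N_1 : x\not\subseteq y \text{ for all } y\in I\}$, and let $N$ be the list (without repetitions) of inclusion-maximal elements of $N_2$. 4. Call FaceIterator$(N, I, J)$ with a copy of $I$ (so that later changes made to $I$ inside this call do not affect the current $I$). 5. Let $C'=\{x\in C : x\not\subseteq a\cup J\}$ and append $a\cup J$ to $I$. 6. Call FaceIterator$(C', I, J)$. (Old variables of the current call may be discarded at this point.) Cost model. Sets are stored as sorted lists of their elements, so the memory needed for a collection of sets is its total length (total number of incidences). For sets $A,B$ of lengths $a,b$ and a (possibly unsorted) list $D$ of $k$ sets of total length $\beta$, the following costs are assumed: finding (and possibly deleting) a given element in $D$ takes time $\mathcal{O}(\beta)$; deleting all duplicates in $D$ takes time $\mathcal{O}(\beta\cdot k)$; computing $A\cap B$ or $A\cup B$ takes time $\mathcal{O}(\max(a,b))$; a subset check $A\subseteq B$ takes time $\mathcal{O}(b)$; checking whether $A$ is a subset of any element of $D$ takes time $\mathcal{O}(\beta)$. *)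

theory Defs
  imports Complex_Main "HOL-Algebra.Lattice"
begin

section \<open>Lattices of sets\<close>

definition inclusion_order :: "'a set set \<Rightarrow> 'a set gorder" where
  "inclusion_order P = \<lparr>carrier = P, eq = (=), le = (\<subseteq>)\<rparr>"

definition covers :: "('a, 'b) gorder_scheme \<Rightarrow> 'a \<Rightarrow> 'a \<Rightarrow> bool" where
  "covers L x y \<longleftrightarrow> x \<in> carrier L \<and> y \<in> carrier L \<and> x \<sqsubset>\<^bsub>L\<^esub> y \<and>
     \<not> (\<exists>z\<in>carrier L. x \<sqsubset>\<^bsub>L\<^esub> z \<and> z \<sqsubset>\<^bsub>L\<^esub> y)"

definition lattice_atoms :: "('a, 'b) gorder_scheme \<Rightarrow> 'a set" where
  "lattice_atoms L = {x. covers L \<bottom>\<^bsub>L\<^esub> x}"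

definition lattice_coatoms :: "('a, 'b) gorder_scheme \<Rightarrow> 'a set" where
  "lattice_coatoms L = {x. covers L x \<top>\<^bsub>L\<^esub>}"

definition locally_branched :: "('a, 'b) gorder_scheme \<Rightarrow> bool" where
  "locally_branched L \<longleftrightarrow>
     (\<forall>a b c. covers L a b \<and> covers L b c \<longrightarrow>
        (\<exists>d\<in>carrier L. d \<noteq> b \<and> a \<sqsubset>\<^bsub>L\<^esub> d \<and> d \<sqsubset>\<^bsub>L\<^esub> c))"

text \<open>
  A (nonempty) lattice given as a meet semi-sublattice of the boolean lattice on \<open>{1..n}\<close>.  Once
  the atoms are the singletons, an element is automatically the set of (labels of) atoms
  below it.  Finiteness follows from \<open>P \<subseteq> Pow {1..n}\<close>.
\<close>

definition meet_semisublattice_of_boolean :: "nat \<Rightarrow> nat set set \<Rightarrow> bool" where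
  "meet_semisublattice_of_boolean n P \<longleftrightarrow>
     P \<subseteq> Pow {1..n} \<and>
     bounded_lattice (inclusion_order P) \<and>
     (\<forall>x\<in>P. \<forall>y\<in>P. x \<sqinter>\<^bsub>inclusion_order P\<^esub> y = x \<inter> y) \<and>
     lattice_atoms (inclusion_order P) = (\<lambda>i. {i}) ` {1..n}"

section \<open>Cost model\<close>

text \<open>A set is stored as the sorted list of its elements, so its length is its cardinality.\<close>

definition total_length :: "nat set list \<Rightarrow> nat" where
  "total_length D = (\<Sum>A\<leftarrow>D. card A)"

datatype operation =
    Find_Element "nat set" "nat set list"   \<comment> \<open>find (and possibly delete) an element of a list\<close>
  | Delete_Duplicates "nat set list"
  | Intersection "nat set" "nat set"
  | Union_Of "nat set" "nat set"
  | Subset_Check "nat set" "nat set"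
  | Subset_Of_Any "nat set" "nat set list"
  | Copy_Sets "nat set list"
  | Output_Set "nat set"
  | Test_Empty
  | Recursive_Call

text \<open>
  The expressions inside the \<open>O\<close> of the assumed costs.  For the bookkeeping the cost
  model does not list, copying and printing are charged by length; testing for emptiness
  and performing a call have no size-dependent part.
\<close>

fun cost_order :: "operation \<Rightarrow> nat" where
  "cost_order (Find_Element A D) = total_length D"
| "cost_order (Delete_Duplicates D) = total_length D * length D"
| "cost_order (Intersection A B) = max (card A) (card B)"
| "cost_order (Union_Of A B) = max (card A) (card B)"
| "cost_order (Subset_Check A B) = card B"
| "cost_order (Subset_Of_Any A D) = total_length D"
| "cost_order (Copy_Sets D) = total_length D"
| "cost_order (Output_Set A) = card A"
| "cost_order Test_Empty = 0"
| "cost_order Recursive_Call = 0"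

text \<open>
  The cost of a single operation may be any function bounded by \<open>K\<close> times the expression
  above plus a constant overhead \<open>e\<close>.  Taking \<open>e = 0\<close> reads the \<open>O\<close> literally (operations on
  lists of total length zero are then free); \<open>e > 0\<close> also charges constant time per operation,
  in particular per recursive call.
\<close>

definition admissible_cost :: "real \<Rightarrow> real \<Rightarrow> (operation \<Rightarrow> real) \<Rightarrow> bool" where
  "admissible_cost K e cost \<longleftrightarrow> (\<forall>p. cost p \<le> K * real (cost_order p) + e)"

definition runtime :: "(operation \<Rightarrow> real) \<Rightarrow> operation list \<Rightarrow> real" where
  "runtime cost ops = (\<Sum>p\<leftarrow>ops. cost p)"

definition recursive_calls :: "operation list \<Rightarrow> nat" where
  "recursive_calls ops = count_list ops Recursive_Call"

section \<open>The algorithm\<close>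

text \<open>
  \<open>face_iterator C I J ops s\<close>: the call FaceIterator\<open>(C, I, J)\<close> has an execution that
  performs the operations \<open>ops\<close> (in this order, including those of all recursive calls) and
  whose peak memory is \<open>s\<close>.  The order in which the lists built during a call are arranged is left
  open, so this is a relation; \<open>face_iterator_terminates\<close> below shows that it is not empty.

  Every variable of a call counts as occupied until it is discarded just before the second
  recursive call.  Thus the memory of a call is added to the peak of the first recursive
  call (whose parameters, including its copy of \<open>I\<close>, are counted there once more), but not to
  the peak of the second one.
\<close>

inductive face_iterator ::
  "nat set list \<Rightarrow> nat set list \<Rightarrow> nat set \<Rightarrow> operation list \<Rightarrow> nat \<Rightarrow> bool" where
  stop: "face_iterator [] I J [Test_Empty] (total_length I + card J)"
| step:
  "\<lbrakk> distinct (a # R);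
     M = map (\<lambda>b. a \<inter> b) R;
     distinct N1; set N1 = set M;
     distinct N2; set N2 = {x \<in> set N1. \<forall>y\<in>set I. \<not> x \<subseteq> y};
     distinct N; set N = {x \<in> set N2. \<forall>y\<in>set N2. \<not> x \<subset> y};
     distinct C'; set C' = {x \<in> set (a # R). \<not> x \<subseteq> a \<union> J};
     face_iterator N I J ops1 s1;
     face_iterator C' (I @ [a \<union> J]) J ops2 s2;
     ops =
       [Test_Empty, Find_Element a (a # R), Intersection a J] @
       (if a \<inter> J = {} then [Output_Set a] else []) @
       map (Intersection a) R @
       [Delete_Duplicates M] @
       map (\<lambda>x. Subset_Of_Any x I) N1 @
       map (\<lambda>x. Find_Element x N1) (filter (\<lambda>x. x \<notin> set N2) N1) @
       concat (map (\<lambda>x. [Find_Element x N2, Subset_Of_Any x (remove1 x N2)]) N2) @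
       [Copy_Sets N, Copy_Sets I, Recursive_Call] @ ops1 @
       [Union_Of a J] @
       map (\<lambda>x. Subset_Check x (a \<union> J)) (a # R) @
       map (\<lambda>x. Find_Element x (a # R)) (filter (\<lambda>x. x \<subseteq> a \<union> J) (a # R)) @
       [Copy_Sets [a \<union> J], Recursive_Call] @ ops2;
     vars1 = total_length ((a # R) @ I @ [J, a, a \<inter> J] @ M @ N1 @ N2 @ N);
     vars2 = vars1 + total_length ([a \<union> J] @ C' @ [a \<union> J]) \<comment> \<open>the second copy is the one in \<open>I\<close>\<close>
   \<rbrakk> \<Longrightarrow> face_iterator (a # R) I J ops (max (vars1 + s1) (max vars2 s2))"

lemma face_iterator_terminates:
  "distinct C \<Longrightarrow> \<exists>ops s. face_iterator C I J ops s"
proof (induction "length C" arbitrary: C I rule: less_induct)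
  case less
  show ?case
  proof (cases C)
    case Nil
    then show ?thesis using stop by blast
  next
    case (Cons a R)
    define M where "M = map (\<lambda>b. a \<inter> b) R"
    define N1 where "N1 = remdups M"
    define N2 where "N2 = filter (\<lambda>x. \<forall>y\<in>set I. \<not> x \<subseteq> y) N1"
    define N where "N = filter (\<lambda>x. \<forall>y\<in>set N2. \<not> x \<subset> y) N2"
    define C' where "C' = filter (\<lambda>x. \<not> x \<subseteq> a \<union> J) (a # R)"
    have "length N \<le> length N2" "length N2 \<le> length N1" "length N1 \<le> length M"
      unfolding N_def N2_def N1_def
      by (rule length_filter_le, rule length_filter_le, rule length_remdups_leq)
    then have lN: "length N < length C" by (simp add: M_def Cons)
    have "a # R = C" using Cons by simp
    have "length C' \<le> length R" by (simp add: C'_def)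
    then have lC': "length C' < length C" by (simp add: Cons)
    have d: "distinct N1" "distinct N2" "distinct N" "distinct C'" "distinct (a # R)"
      using less.prems Cons by (auto simp: N1_def N2_def N_def C'_def)
    obtain ops1 s1 where 1: "face_iterator N I J ops1 s1"
      using less.hyps[OF lN d(3)] by blast
    obtain ops2 s2 where 2: "face_iterator C' (I @ [a \<union> J]) J ops2 s2"
      using less.hyps[OF lC' d(4)] by blast
    have s: "set N1 = set M" "set N2 = {x \<in> set N1. \<forall>y\<in>set I. \<not> x \<subseteq> y}"
      "set N = {x \<in> set N2. \<forall>y\<in>set N2. \<not> x \<subset> y}"
      "set C' = {x \<in> set (a # R). \<not> x \<subseteq> a \<union> J}"
      by (auto simp: N1_def N2_def N_def C'_def)
    show ?thesis unfolding Cons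
      using step[OF d(5) M_def d(1) s(1) d(2) s(2) d(3) s(3) d(4) s(4) 1 2 refl refl refl]
      by blast
  qed
qed

end

theory Submission
  imports Defs
begin

text \<open>
  Both bounds rest on the potential \<open>\<Sum>a\<in>C \<union> I. |a \<union> J|\<close>, which never increases: the elements of
  \<open>N\<close> are distinct sets \<open>a \<inter> b\<close> with \<open>b \<in> C - {a}\<close>, and \<open>C'\<close> loses \<open>a\<close> exactly when \<open>I\<close> gains
  \<open>a \<union> J\<close>.  The length of \<open>C\<close> does not increase either.  Hence each call uses memory
  \<open>O(\<alpha>)\<close> and time \<open>O(\<alpha> \<cdot> m)\<close> of its own.  Memory accumulates only along nested first recursive calls,
  and since \<open>C\<close> is always an antichain, passing from \<open>C\<close> to \<open>N\<close> strictly descends below \<open>a\<close>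
  in \<open>P\<close>; thus the nesting depth is at most \<open>r\<close>.
\<close>

section \<open>Sums of cardinalities over lists of sets\<close>

definition weight :: "nat set \<Rightarrow> nat set list \<Rightarrow> nat" where
  "weight J D = (\<Sum>A\<leftarrow>D. card (A \<union> J))"

lemma weight_simps [simp]:
  "weight J [] = 0"
  "weight J (A # D) = card (A \<union> J) + weight J D"
  "weight J (D @ E) = weight J D + weight J E"
  by (simp_all add: weight_def)

lemma total_length_simps [simp]:
  "total_length [] = 0"
  "total_length (A # D) = card A + total_length D"
  "total_length (D @ E) = total_length D + total_length E"
  by (simp_all add: total_length_def)

lemma card_mem_le_total_length: "A \<in> set D \<Longrightarrow> card A \<le> total_length D"
  by (induction D) auto

lemma card_mem_le_weight: "A \<in> set D \<Longrightarrow> card (A \<union> J) \<le> weight J D"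
  by (induction D) auto

lemma total_length_le_weight:
  "finite J \<Longrightarrow> (\<And>A. A \<in> set D \<Longrightarrow> finite A) \<Longrightarrow> total_length D \<le> weight J D"
  by (induction D) (auto intro!: add_mono card_mono)

text \<open>Both sums are compared with the sum over the set of entries of \<open>ys\<close>:
  repetitions in \<open>ys\<close> only add to its list sum. They do occur, since distinct sets
  \<open>b\<close> may give the same \<open>a \<inter> b\<close> in \<open>M\<close>. No order of
  the lists enters, which suits an algorithm whose lists are fixed only as sets.\<close>

lemma sum_list_distinct_le:
  fixes g :: "'a \<Rightarrow> nat"
  assumes "distinct xs" "set xs \<subseteq> set ys"
  shows "(\<Sum>x\<leftarrow>xs. g x) \<le> (\<Sum>y\<leftarrow>ys. g y)"
proof -
  have "(\<Sum>x\<in>set ys. g x) \<le> (\<Sum>y\<leftarrow>ys. g y)"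
    by (induction ys) (auto simp: sum.insert_if)
  moreover have "(\<Sum>x\<leftarrow>xs. g x) \<le> (\<Sum>x\<in>set ys. g x)"
    using assms by (simp add: sum_list_distinct_conv_sum_set sum_mono2)
  ultimately show ?thesis by linarith
qed

lemma length_distinct_le: "distinct xs \<Longrightarrow> set xs \<subseteq> set ys \<Longrightarrow> length xs \<le> length ys"
  using sum_list_distinct_le[of xs ys "\<lambda>_. 1"] by (simp add: sum_list_triv)

lemma weight_distinct_le: "distinct D \<Longrightarrow> set D \<subseteq> set E \<Longrightarrow> weight J D \<le> weight J E"
  unfolding weight_def by (rule sum_list_distinct_le)

lemma total_length_distinct_le:
  "distinct D \<Longrightarrow> set D \<subseteq> set E \<Longrightarrow> total_length D \<le> total_length E"
  unfolding total_length_def by (rule sum_list_distinct_le)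

lemma weight_map_Int_le:
  "finite J \<Longrightarrow> (\<And>b. b \<in> set R \<Longrightarrow> finite b) \<Longrightarrow> weight J (map (\<lambda>b. a \<inter> b) R) \<le> weight J R"
  by (induction R) (auto intro!: add_mono card_mono)

lemma total_length_map_Int_le:
  "(\<And>b. b \<in> set R \<Longrightarrow> finite b) \<Longrightarrow> total_length (map (\<lambda>b. a \<inter> b) R) \<le> total_length R"
  by (induction R) (auto intro!: add_mono card_mono)

lemma sum_list_le_mult:
  fixes g :: "'a \<Rightarrow> nat"
  shows "(\<And>x. x \<in> set xs \<Longrightarrow> g x \<le> c) \<Longrightarrow> length xs \<le> m \<Longrightarrow> (\<Sum>x\<leftarrow>xs. g x) \<le> c * m"
proof -
  assume "\<And>x. x \<in> set xs \<Longrightarrow> g x \<le> c" and m: "length xs \<le> m"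
  then have "(\<Sum>x\<leftarrow>xs. g x) \<le> c * length xs"
    by (induction xs) (auto intro: add_mono)
  also have "\<dots> \<le> c * m" using m by simp
  finally show ?thesis .
qed

lemma sum_list_map_concat:
  fixes g :: "'a \<Rightarrow> nat"
  shows "sum_list (map g (concat xss)) = (\<Sum>xs\<leftarrow>xss. sum_list (map g xs))"
  by (induction xss) auto

section \<open>A single call with nonempty \<open>C\<close>: invariants, own memory and own
  operations\<close>

text \<open>Packages the data that the rule \<open>step\<close> supplies, so that the inductions for
  time and for memory share one analysis of a call. Finiteness is kept as an invariant because
  \<open>card\<close> is 0 on infinite sets.\<close>

locale iterator_step =
  fixes a :: "nat set" and R I :: "nat set list" and J :: "nat set"
    and M N1 N2 N C' :: "nat set list"
  assumes distinct_C: "distinct (a # R)"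
    and M: "M = map (\<lambda>b. a \<inter> b) R"
    and N1: "distinct N1" "set N1 = set M"
    and N2: "distinct N2" "set N2 = {x \<in> set N1. \<forall>y\<in>set I. \<not> x \<subseteq> y}"
    and N: "distinct N" "set N = {x \<in> set N2. \<forall>y\<in>set N2. \<not> x \<subset> y}"
    and C': "distinct C'" "set C' = {x \<in> set (a # R). \<not> x \<subseteq> a \<union> J}"
    and finite_J: "finite J"
    and finite_sets: "\<And>A. A \<in> set (a # R) \<union> set I \<Longrightarrow> finite A"
begin

lemma subsets: "set N1 \<subseteq> set M" "set N2 \<subseteq> set M" "set N \<subseteq> set M" "set C' \<subseteq> set R"
  using N1 N2 N C' by auto

lemma lengths:
  "length M = length R" "length N1 \<le> length R" "length N2 \<le> length R" "length N \<le> length R"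
  "length C' \<le> length R"
  using length_distinct_le[OF N1(1) subsets(1)] length_distinct_le[OF N2(1) subsets(2)]
    length_distinct_le[OF N(1) subsets(3)] length_distinct_le[OF C'(1) subsets(4)]
  by (simp_all add: M)

lemma total_lengths:
  "total_length M \<le> total_length R" "total_length N1 \<le> total_length R"
  "total_length N2 \<le> total_length R" "total_length N \<le> total_length R"
  "total_length C' \<le> total_length R"
proof -
  show M': "total_length M \<le> total_length R"
    unfolding M by (rule total_length_map_Int_le) (simp add: finite_sets)
  show "total_length N1 \<le> total_length R" "total_length N2 \<le> total_length R"
    "total_length N \<le> total_length R" "total_length C' \<le> total_length R"
    using total_length_distinct_le[OF N1(1) subsets(1)]
      total_length_distinct_le[OF N2(1) subsets(2)]
      total_length_distinct_le[OF N(1) subsets(3)]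
      total_length_distinct_le[OF C'(1) subsets(4)] M'
    by simp_all
qed

text \<open>For the first call, \<open>(a \<inter> b) \<union> J\<close> lies in
  \<open>b \<union> J\<close>, so \<open>N\<close> weighs at most as much as \<open>R\<close>. For
  the second, the appended \<open>a \<union> J\<close> has exactly the weight of the removed
  \<open>a\<close>, because \<open>J\<close> is absorbed. With plain lengths the second bound could
  fail, as \<open>a \<union> J\<close> may be larger than \<open>a\<close>.\<close>

lemma weights:
  "weight J (N @ I) \<le> weight J ((a # R) @ I)"
  "weight J (C' @ I @ [a \<union> J]) \<le> weight J ((a # R) @ I)"
proof -
  have "weight J N \<le> weight J M"
    by (rule weight_distinct_le[OF N(1) subsets(3)])
  also have "\<dots> \<le> weight J R"
    unfolding M by (rule weight_map_Int_le) (simp_all add: finite_J finite_sets)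
  finally show "weight J (N @ I) \<le> weight J ((a # R) @ I)" by simp
  have "weight J C' \<le> weight J R"
    by (rule weight_distinct_le[OF C'(1) subsets(4)])
  then show "weight J (C' @ I @ [a \<union> J]) \<le> weight J ((a # R) @ I)"
    by (simp add: Un_assoc)
qed

lemma sizes:
  "total_length (a # R) \<le> weight J ((a # R) @ I)"
  "total_length I \<le> weight J ((a # R) @ I)"
  "total_length ((a # R) @ I) \<le> weight J ((a # R) @ I)"
  "card J \<le> weight J ((a # R) @ I)"
  "card a \<le> weight J ((a # R) @ I)"
  "card (a \<union> J) \<le> weight J ((a # R) @ I)"
  "card (a \<inter> J) \<le> weight J ((a # R) @ I)"
proof -
  show *: "total_length ((a # R) @ I) \<le> weight J ((a # R) @ I)"
    by (rule total_length_le_weight) (auto simp: finite_J finite_sets)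
  show "total_length (a # R) \<le> weight J ((a # R) @ I)"
    "total_length I \<le> weight J ((a # R) @ I)" "card a \<le> weight J ((a # R) @ I)"
    using * by simp_all
  show u: "card (a \<union> J) \<le> weight J ((a # R) @ I)" by simp
  have f: "finite (a \<union> J)" using finite_J finite_sets by simp
  have "card J \<le> card (a \<union> J)" "card (a \<inter> J) \<le> card (a \<union> J)"
    by (auto intro!: card_mono f)
  with u show "card J \<le> weight J ((a # R) @ I)" "card (a \<inter> J) \<le> weight J ((a # R) @ I)"
    by linarith+
qed

lemma finite_N: "A \<in> set N \<union> set I \<Longrightarrow> finite A"
  using subsets(3) finite_sets by (auto simp: M)

lemma finite_C': "A \<in> set C' \<union> set (I @ [a \<union> J]) \<Longrightarrow> finite A"
  using subsets(4) finite_sets finite_J by auto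

text \<open>The factor 11 counts blocks of size at most \<open>A\<close>: one for \<open>C\<close>
  together with \<open>I\<close>, three for \<open>J\<close>, \<open>a\<close> and
  \<open>a \<inter> J\<close>, four for \<open>M\<close>, \<open>N1\<close>, \<open>N2\<close>,
  \<open>N\<close>, one for \<open>C'\<close>, and two for the copies of
  \<open>a \<union> J\<close>.\<close>

lemma memory:
  assumes A: "weight J ((a # R) @ I) \<le> A"
  shows "total_length ((a # R) @ I @ [J, a, a \<inter> J] @ M @ N1 @ N2 @ N) +
      total_length ([a \<union> J] @ C' @ [a \<union> J]) \<le> 11 * A"
proof -
  have R: "total_length R \<le> A" using sizes(1) A by simp
  have "total_length ((a # R) @ I) \<le> A" "card J \<le> A" "card a \<le> A" "card (a \<union> J) \<le> A"
    "card (a \<inter> J) \<le> A"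
    using sizes(3-) A by linarith+
  moreover have "total_length M \<le> A" "total_length N1 \<le> A" "total_length N2 \<le> A"
    "total_length N \<le> A" "total_length C' \<le> A"
    using total_lengths R by linarith+
  ultimately show ?thesis by simp
qed

text \<open>The trace of \<open>step\<close> with \<open>ops1\<close> and \<open>ops2\<close> cut
  out, but with both \<open>Recursive_Call\<close> entries kept. Cost sums, lengths and counts
  ignore positions, so each of them splits into the parts for \<open>own_ops\<close>,
  \<open>ops1\<close> and \<open>ops2\<close>.\<close>

definition own_ops :: "operation list" where
  "own_ops =
     [Test_Empty, Find_Element a (a # R), Intersection a J] @
     (if a \<inter> J = {} then [Output_Set a] else []) @
     map (Intersection a) R @
     [Delete_Duplicates M] @
     map (\<lambda>x. Subset_Of_Any x I) N1 @
     map (\<lambda>x. Find_Element x N1) (filter (\<lambda>x. x \<notin> set N2) N1) @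
     concat (map (\<lambda>x. [Find_Element x N2, Subset_Of_Any x (remove1 x N2)]) N2) @
     [Copy_Sets N, Copy_Sets I, Recursive_Call] @
     [Union_Of a J] @
     map (\<lambda>x. Subset_Check x (a \<union> J)) (a # R) @
     map (\<lambda>x. Find_Element x (a # R)) (filter (\<lambda>x. x \<subseteq> a \<union> J) (a # R)) @
     [Copy_Sets [a \<union> J], Recursive_Call]"

lemma recursive_calls_own_ops: "recursive_calls own_ops = 2"
  by (auto simp: own_ops_def recursive_calls_def count_list_0_iff)

text \<open>The strict inequality is needed later: each subcall brings an additive 1 in its length
  bound, and one of these two has to be absorbed here.\<close>

lemma length_own_ops:
  assumes "length (a # R) \<le> m"
  shows "length own_ops < 20 * m"
proof -
  have "length (concat (map (\<lambda>x. [Find_Element x N2, Subset_Of_Any x (remove1 x N2)]) N2))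
      = 2 * length N2"
    by (simp add: length_concat comp_def sum_list_triv)
  moreover have "length (filter (\<lambda>x. x \<notin> set N2) N1) \<le> length N1"
    "length (filter (\<lambda>x. x \<subseteq> a \<union> J) (a # R)) \<le> length (a # R)"
    by (rule length_filter_le)+
  ultimately show ?thesis
    using lengths assms by (simp add: own_ops_def del: filter.simps length_filter_le)
qed

text \<open>Seven summands are at most \<open>A\<close>, and the others add up to at most
  \<open>8 * (A * m)\<close>, the loop over \<open>N2\<close> counting twice. The total of 15 is
  rounded up to 16, which splits evenly over the two recursive calls.\<close>

lemma work_own_ops:
  assumes m: "length (a # R) \<le> m" and A: "weight J ((a # R) @ I) \<le> A"
  shows "(\<Sum>p\<leftarrow>own_ops. cost_order p) \<le> 16 * (A * m)"
proof -
  \<comment> \<open>The list \<open>a # R\<close> is nonempty, so \<open>m\<close> is at least 1 and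
    the single operations are absorbed into \<open>A * m\<close>.\<close>
  have Am: "A \<le> A * m" using m by (cases m) auto
  have C: "total_length (a # R) \<le> A" "total_length I \<le> A" "card J \<le> A" "card a \<le> A"
    "card (a \<union> J) \<le> A"
    using sizes A by linarith+
  have T: "total_length M \<le> A" "total_length N1 \<le> A" "total_length N2 \<le> A" "total_length N \<le> A"
    using total_lengths C(1) by auto
  have L: "length R \<le> m" "length N1 \<le> m" "length N2 \<le> m"
    using lengths m by auto
  have 1: "(\<Sum>b\<leftarrow>R. max (card a) (card b)) \<le> A * m"
  proof (rule sum_list_le_mult[OF _ L(1)])
    fix b assume "b \<in> set R"
    then have "card b \<le> total_length (a # R)" by (simp add: card_mem_le_total_length trans_le_add2)
    then show "max (card a) (card b) \<le> A" using C by simp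
  qed
  have 2: "total_length M * length M \<le> A * m"
    using T(1) lengths(1) L(1) by (simp add: mult_mono)
  have 3: "(\<Sum>x\<leftarrow>N1. total_length I) \<le> A * m"
    by (rule sum_list_le_mult[OF C(2) L(2)])
  have 4: "(\<Sum>x\<leftarrow>filter (\<lambda>x. x \<notin> set N2) N1. total_length N1) \<le> A * m"
    by (rule sum_list_le_mult[OF T(2)]) (rule order_trans[OF length_filter_le L(2)])
  have 5: "(\<Sum>x\<leftarrow>N2. total_length N2 + total_length (remove1 x N2)) \<le> (2 * A) * m"
  proof (rule sum_list_le_mult[OF _ L(3)])
    fix x
    have "total_length (remove1 x N2) \<le> total_length N2"
      by (rule total_length_distinct_le) (use N2(1) set_remove1_subset in auto)
    then show "total_length N2 + total_length (remove1 x N2) \<le> 2 * A" using T(3) by simp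
  qed
  have 6: "(\<Sum>x\<leftarrow>a # R. card (a \<union> J)) \<le> A * m"
    by (rule sum_list_le_mult[OF C(5) m])
  have 7: "(\<Sum>x\<leftarrow>filter (\<lambda>x. x \<subseteq> a \<union> J) (a # R). total_length (a # R)) \<le> A * m"
    by (rule sum_list_le_mult[OF C(1)]) (rule order_trans[OF length_filter_le m])
  have 8: "(\<Sum>p\<leftarrow>(if a \<inter> J = {} then [Output_Set a] else []). cost_order p) \<le> A"
    using C(4) by simp
  have 9: "max (card a) (card J) \<le> A" using C by simp
  have "(\<Sum>p\<leftarrow>own_ops. cost_order p) =
      total_length (a # R) + max (card a) (card J) +
      (\<Sum>p\<leftarrow>(if a \<inter> J = {} then [Output_Set a] else []). cost_order p) +
      (\<Sum>b\<leftarrow>R. max (card a) (card b)) + total_length M * length M + (\<Sum>x\<leftarrow>N1. total_length I) +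
      (\<Sum>x\<leftarrow>filter (\<lambda>x. x \<notin> set N2) N1. total_length N1) +
      (\<Sum>x\<leftarrow>N2. total_length N2 + total_length (remove1 x N2)) +
      total_length N + total_length I + max (card a) (card J) +
      (\<Sum>x\<leftarrow>a # R. card (a \<union> J)) +
      (\<Sum>x\<leftarrow>filter (\<lambda>x. x \<subseteq> a \<union> J) (a # R). total_length (a # R)) + card (a \<union> J)"
    by (simp add: own_ops_def sum_list_map_concat comp_def del: filter.simps sum_list_triv)
  then show ?thesis
    using 1 2 3 4 5 6 7 8 9 C T Am by linarith
qed

end

section \<open>Time and memory of a whole run\<close>

text \<open>Amortisation: a nonempty call makes two recursive calls, so its own work is paid by
  charging \<open>8 * (A * m)\<close> to each of them; \<open>m\<close> and \<open>A\<close> remain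
  valid bounds in the subcalls. An empty call makes none, and its \<open>Test_Empty\<close> has cost
  order 0 but is still one operation, hence the \<open>+ 1\<close>. The last conjunct later makes
  the number of calls positive when \<open>C\<close> is nonempty.\<close>

lemma face_iterator_work:
  assumes "face_iterator C I J ops s"
    and "finite J" "\<And>A. A \<in> set C \<union> set I \<Longrightarrow> finite A"
    and "length C \<le> m" "weight J (C @ I) \<le> A"
  shows "(\<Sum>p\<leftarrow>ops. cost_order p) \<le> 8 * (A * m * recursive_calls ops) \<and>
    length ops \<le> 10 * (m * recursive_calls ops) + 1 \<and>
    (C \<noteq> [] \<longrightarrow> 0 < recursive_calls ops)"
  using assms
proof (induction rule: face_iterator.induct)
  case (stop I J)
  then show ?case by simp
next
  case (step a R M N1 N2 I N C' J ops1 s1 ops2 s2 ops vars1 vars2)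
  interpret iterator_step a R I J M N1 N2 N C'
    by (rule iterator_step.intro) (fact step.hyps step.prems)+
  let ?q1 = "recursive_calls ops1" and ?q2 = "recursive_calls ops2"
  have IH1: "(\<Sum>p\<leftarrow>ops1. cost_order p) \<le> 8 * (A * m * ?q1) \<and>
      length ops1 \<le> 10 * (m * ?q1) + 1 \<and> (N \<noteq> [] \<longrightarrow> 0 < ?q1)"
  proof (rule step.IH(1)[OF finite_J finite_N])
    show "length N \<le> m" using lengths step.prems(3) by simp
    show "weight J (N @ I) \<le> A" using weights(1) step.prems(4) by linarith
  qed
  have IH2: "(\<Sum>p\<leftarrow>ops2. cost_order p) \<le> 8 * (A * m * ?q2) \<and>
      length ops2 \<le> 10 * (m * ?q2) + 1 \<and> (C' \<noteq> [] \<longrightarrow> 0 < ?q2)"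
  proof (rule step.IH(2)[OF finite_J finite_C'])
    show "length C' \<le> m" using lengths step.prems(3) by simp
    show "weight J (C' @ I @ [a \<union> J]) \<le> A" using weights(2) step.prems(4) by linarith
  qed
  note ops = step.hyps(13)
  have "recursive_calls ops = recursive_calls own_ops + ?q1 + ?q2"
    unfolding ops own_ops_def recursive_calls_def by (simp del: filter.simps)
  then have q: "recursive_calls ops = 2 + ?q1 + ?q2"
    by (simp only: recursive_calls_own_ops)
  have w: "(\<Sum>p\<leftarrow>ops. cost_order p) =
      (\<Sum>p\<leftarrow>own_ops. cost_order p) + (\<Sum>p\<leftarrow>ops1. cost_order p) + (\<Sum>p\<leftarrow>ops2. cost_order p)"
    unfolding ops own_ops_def by (simp del: filter.simps)
  have l: "length ops = length own_ops + length ops1 + length ops2"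
    unfolding ops own_ops_def by (simp del: filter.simps)
  have "(\<Sum>p\<leftarrow>ops. cost_order p) \<le> 8 * (A * m * recursive_calls ops)"
    using work_own_ops[OF step.prems(3,4)] IH1 IH2 unfolding w q by (simp add: distrib_left)
  moreover have "length ops \<le> 10 * (m * recursive_calls ops) + 1"
    using length_own_ops[OF step.prems(3)] IH1 IH2 unfolding l q by (simp add: distrib_left)
  ultimately show ?case using q by simp
qed

lemma runtime_le:
  assumes "admissible_cost K e cost"
  shows "runtime cost ops \<le> K * real (\<Sum>p\<leftarrow>ops. cost_order p) + e * real (length ops)"
proof (induction ops)
  case (Cons p ops)
  have "cost p \<le> K * real (cost_order p) + e"
    using assms by (simp add: admissible_cost_def)
  with Cons show ?case by (simp add: runtime_def distrib_left)
qed (simp add: runtime_def)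

text \<open>\<open>d\<close> bounds the number of nested first calls still possible. A first call
  lowers \<open>d\<close> by one, which pays \<open>11 * A\<close> for the variables kept meanwhile;
  a second call keeps \<open>d\<close> and enters only through a maximum. The remaining
  \<open>2 * A\<close> covers \<open>I\<close> and \<open>J\<close> in a call that stops.
  \<open>card J \<le> A\<close> is a separate hypothesis because the weight vanishes when
  \<open>C\<close> and \<open>I\<close> are empty, even if \<open>J\<close> is not.\<close>

lemma face_iterator_memory:
  fixes rank :: "nat set \<Rightarrow> nat" and P :: "nat set set"
  assumes "face_iterator C I J ops s"
    and "finite J" "\<And>A. A \<in> set C \<union> set I \<Longrightarrow> finite A"
    and "weight J (C @ I) \<le> A" "card J \<le> A"
    and "\<And>x y. x \<in> P \<Longrightarrow> y \<in> P \<Longrightarrow> x \<inter> y \<in> P"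
    and "\<And>x y. x \<in> P \<Longrightarrow> y \<in> P \<Longrightarrow> x \<subset> y \<Longrightarrow> rank x < rank y"
    and "set C \<subseteq> P" "\<And>x y. x \<in> set C \<Longrightarrow> y \<in> set C \<Longrightarrow> \<not> x \<subset> y"
    and "\<And>c. c \<in> set C \<Longrightarrow> rank c < d"
  shows "s \<le> (11 * d + 2) * A"
  using assms
proof (induction arbitrary: d rule: face_iterator.induct)
  case (stop I J)
  have "total_length I \<le> weight J I"
    using stop.prems by (intro total_length_le_weight) auto
  then have "total_length I + card J \<le> 2 * A"
    using stop.prems(3,4) by simp
  also have "\<dots> \<le> (11 * d + 2) * A" by (rule mult_right_mono) auto
  finally show ?case .
next
  case (step a R M N1 N2 I N C' J ops1 s1 ops2 s2 ops vars1 vars2)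
  interpret iterator_step a R I J M N1 N2 N C'
    by (rule iterator_step.intro) (fact step.hyps step.prems)+
  note closed = step.prems(5) and rank = step.prems(6) and sub = step.prems(7)
    and antichain = step.prems(8) and depth = step.prems(9)
  obtain k where d: "d = Suc k"
    using depth[of a] by (cases d) auto
  \<comment> \<open>The antichain property enters here: \<open>a \<inter> b = a\<close> would put
    \<open>a\<close> strictly below the distinct element \<open>b\<close>.\<close>
  have N_below: "x \<in> P" "x \<subset> a" if "x \<in> set N" for x
  proof -
    have "x \<in> set M" using that subsets(3) by blast
    then obtain b where b: "b \<in> set R" "x = a \<inter> b" by (auto simp: M)
    then have "a \<noteq> b" using distinct_C by auto
    moreover have "\<not> a \<subset> b" using antichain[of a b] b by simp
    ultimately show "x \<subset> a" using b by blast
    show "x \<in> P" using b sub closed by auto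
  qed
  have s1: "s1 \<le> (11 * k + 2) * A"
  proof (rule step.IH(1)[OF finite_J finite_N _ step.prems(4) closed rank])
    show "weight J (N @ I) \<le> A" using weights(1) step.prems(3) by linarith
    show "set N \<subseteq> P" using N_below by blast
    show "\<not> x \<subset> y" if "x \<in> set N" "y \<in> set N" for x y
      using that N(2) by blast
    show "rank c < k" if "c \<in> set N" for c
    proof -
      have "rank c < rank a" using N_below[OF that] rank sub by simp
      with depth[of a] d show ?thesis by simp
    qed
  qed
  \<comment> \<open>\<open>C'\<close> consists of members of \<open>C\<close>, so the antichain
    property and the same \<open>d\<close> carry over.\<close>
  have s2: "s2 \<le> (11 * d + 2) * A"
  proof (rule step.IH(2)[OF finite_J finite_C' _ step.prems(4) closed rank])
    show "weight J (C' @ I @ [a \<union> J]) \<le> A" using weights(2) step.prems(3) by linarith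
    show "set C' \<subseteq> P" using subsets(4) sub by auto
    show "\<not> x \<subset> y" if "x \<in> set C'" "y \<in> set C'" for x y
      using that subsets(4) antichain by (meson list.set_intros(2) subsetD)
    show "rank c < d" if "c \<in> set C'" for c
      using that subsets(4) depth by (meson list.set_intros(2) subsetD)
  qed
  note vars = step.hyps(14,15)
  have "vars2 \<le> 11 * A"
    using memory[OF step.prems(3)] by (simp only: vars)
  moreover have "vars1 \<le> vars2" by (simp only: vars(2) le_add1)
  moreover have "11 * A + (11 * k + 2) * A = (11 * d + 2) * A"
    by (simp add: d algebra_simps)
  moreover have "11 * A \<le> (11 * d + 2) * A"
    by (rule mult_right_mono) (auto simp: d)
  ultimately show ?case using s1 s2 by linarith
qed

section \<open>Height of an element in a finite family of sets\<close>

text \<open>This is the height of \<open>x\<close> in \<open>P\<close>. Counting only elements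
  strictly below \<open>x\<close> gives minimal elements height 0.\<close>

definition chain_rank :: "'a set set \<Rightarrow> 'a set \<Rightarrow> nat" where
  "chain_rank P x = Max (card ` {X. subset.chain P X \<and> (\<forall>y\<in>X. y \<subset> x)})"

context
  fixes P :: "'a set set"
  assumes finite_P: "finite P"
begin

lemma finite_chains: "finite {X. subset.chain P X \<and> Q X}"
  by (rule finite_subset[of _ "Pow P"]) (auto simp: subset.chain_def finite_P)

text \<open>The empty chain guarantees that the maximum is attained. Putting \<open>x\<close> on top
  of a maximal witness yields the longer chain from which both later comparisons follow.\<close>

lemma chain_below_obtain:
  assumes "x \<in> P"
  obtains X where "subset.chain P X" "\<And>y. y \<in> X \<Longrightarrow> y \<subset> x" "card X = chain_rank P x"
    "subset.chain P (insert x X)" "card (insert x X) = chain_rank P x + 1"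
proof -
  let ?S = "{X. subset.chain P X \<and> (\<forall>y\<in>X. y \<subset> x)}"
  have "{} \<in> ?S" by simp
  then have "card ` ?S \<noteq> {}" by blast
  then have "chain_rank P x \<in> card ` ?S"
    unfolding chain_rank_def by (intro Max_in finite_imageI finite_chains)
  then obtain X where X: "subset.chain P X" "\<And>y. y \<in> X \<Longrightarrow> y \<subset> x" "card X = chain_rank P x"
    by auto
  have "finite X" using X(1) finite_P by (auto simp: subset.chain_def intro: finite_subset)
  moreover have "x \<notin> X" using X(2) by blast
  ultimately have "card (insert x X) = chain_rank P x + 1" using X(3) by simp
  moreover have "subset.chain P (insert x X)"
    using X assms by (auto simp: subset_chain_def)
  ultimately show thesis using X that by blast
qed

lemma chain_rank_strict_mono:
  assumes "x \<in> P" "x \<subset> y"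
  shows "chain_rank P x < chain_rank P y"
proof -
  obtain X where X: "\<And>z. z \<in> X \<Longrightarrow> z \<subset> x" "subset.chain P (insert x X)"
      "card (insert x X) = chain_rank P x + 1"
    using chain_below_obtain[OF assms(1)] by metis
  have "card (insert x X) \<le> chain_rank P y"
    unfolding chain_rank_def
  proof (intro Max_ge finite_imageI finite_chains imageI CollectI conjI X(2))
    show "\<forall>z\<in>insert x X. z \<subset> y" using X(1) assms(2) by (metis insert_iff psubset_trans)
  qed
  with X(3) show ?thesis by simp
qed

lemma card_chain_le_Max:
  "subset.chain P X \<Longrightarrow> card X \<le> Max (card ` {X. subset.chain P X})"
  using finite_chains[of "\<lambda>_. True"] by (intro Max_ge) auto

lemma chain_rank_less_Max:
  assumes "x \<in> P"
  shows "chain_rank P x < Max (card ` {X. subset.chain P X})"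
  using chain_below_obtain[OF assms] card_chain_le_Max by (metis Suc_eq_plus1 Suc_le_lessD)

end

section \<open>Coatoms and chains of a lattice of sets, and the run on its coatoms\<close>

lemma inclusion_order_sel [simp]:
  "carrier (inclusion_order P) = P"
  "x \<sqsubset>\<^bsub>inclusion_order P\<^esub> y \<longleftrightarrow> x \<subset> y"
  by (auto simp: inclusion_order_def lless_def)

lemma coatoms_inclusion_order:
  "c \<in> lattice_coatoms (inclusion_order P) \<longleftrightarrow>
     c \<in> P \<and> \<top>\<^bsub>inclusion_order P\<^esub> \<in> P \<and> c \<subset> \<top>\<^bsub>inclusion_order P\<^esub> \<and>
     \<not> (\<exists>z\<in>P. c \<subset> z \<and> z \<subset> \<top>\<^bsub>inclusion_order P\<^esub>)"
  by (simp add: lattice_coatoms_def covers_def)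

context
  fixes n :: nat and P :: "nat set set"
  assumes boolean: "meet_semisublattice_of_boolean n P"
begin

lemma finite_lattice: "finite P"
  using boolean by (auto simp: meet_semisublattice_of_boolean_def intro: finite_subset)

lemma bounded: "bounded_lattice (inclusion_order P)"
  using boolean by (simp add: meet_semisublattice_of_boolean_def)

lemma Int_closed:
  assumes "x \<in> P" "y \<in> P"
  shows "x \<inter> y \<in> P"
proof -
  interpret bounded_lattice "inclusion_order P" by (rule bounded)
  have "x \<sqinter>\<^bsub>inclusion_order P\<^esub> y \<in> P"
    using meet_closed[of x y] assms by simp
  with assms boolean show ?thesis by (simp add: meet_semisublattice_of_boolean_def)
qed

lemma top: "\<top>\<^bsub>inclusion_order P\<^esub> \<in> P" "x \<in> P \<Longrightarrow> x \<subseteq> \<top>\<^bsub>inclusion_order P\<^esub>"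
proof -
  interpret bounded_lattice "inclusion_order P" by (rule bounded)
  show "\<top>\<^bsub>inclusion_order P\<^esub> \<in> P" using top_closed by simp
  show "x \<in> P \<Longrightarrow> x \<subseteq> \<top>\<^bsub>inclusion_order P\<^esub>"
    using top_higher[of x] by (simp add: inclusion_order_def)
qed

text \<open>The witness is the bottom element, covered by the atom \<open>{1}\<close>. It shows that
  \<open>P\<close> has two comparable elements as soon as \<open>n\<close> is positive.\<close>

lemma below_singleton_obtain:
  assumes "0 < n"
  obtains z where "z \<in> P" "{1} \<in> P" "z \<subset> {1}"
proof -
  have "{1} \<in> lattice_atoms (inclusion_order P)"
    using assms boolean by (auto simp: meet_semisublattice_of_boolean_def)
  with that show thesis by (auto simp: lattice_atoms_def covers_def)
qed

lemma coatom_exists: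
  assumes "0 < n"
  shows "lattice_coatoms (inclusion_order P) \<noteq> {}"
proof -
  let ?t = "\<top>\<^bsub>inclusion_order P\<^esub>"
  obtain z where z: "z \<in> P" "{1} \<in> P" "z \<subset> {1}"
    using below_singleton_obtain[OF assms] .
  then have "z \<in> P - {?t}" using top(2)[of "{1}"] by auto
  then obtain c where c: "c \<in> P - {?t}" "\<And>y. y \<in> P - {?t} \<Longrightarrow> c \<subseteq> y \<Longrightarrow> c = y"
    using finite_has_maximal[of "P - {?t}"] finite_lattice by (metis empty_iff finite_Diff)
  then have "c \<in> lattice_coatoms (inclusion_order P)"
    using top by (auto simp: coatoms_inclusion_order)
  then show ?thesis by auto
qed

lemma longest_chain_ge_2:
  assumes "0 < n"
  shows "2 \<le> Max (card ` {X. subset.chain P X})"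
proof -
  obtain z where z: "z \<in> P" "{1} \<in> P" "z \<subset> {1}"
    using below_singleton_obtain[OF assms] .
  then have "subset.chain P {z, {1}}" by (auto simp: subset_chain_def)
  moreover have "card {z, {1}} = 2" using z by (simp add: card_insert_if)
  ultimately show ?thesis using card_chain_le_Max[OF finite_lattice] by metis
qed

lemma coatoms_memory:
  assumes I: "set I \<subseteq> Pow {1..n}" and J: "J \<subseteq> {1..n}"
    and C: "set C = {c \<in> lattice_coatoms (inclusion_order P). \<forall>y\<in>set I. \<not> c \<subseteq> y}"
    and r: "r + 1 = Max (card ` {X. subset.chain P X})"
    and run: "face_iterator C I J ops s"
  shows "s \<le> 13 * (weight J (C @ I) * r)"
proof -
  have CP: "set C \<subseteq> P" using C by (auto simp: coatoms_inclusion_order)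
  have PB: "P \<subseteq> Pow {1..n}" using boolean by (simp add: meet_semisublattice_of_boolean_def)
  have fin: "finite A" if "A \<in> set C \<union> set I" for A
    using that CP PB I by (intro finite_subset[of A "{1..n}"]) auto
  have fJ: "finite J" using J by (rule finite_subset) simp
  \<comment> \<open>If \<open>n = 0\<close> then \<open>J\<close> is empty. Otherwise a coatom
    exists, and an empty \<open>I\<close> cannot exclude it, so \<open>C @ I\<close> has an entry
    whose weight dominates \<open>card J\<close>.\<close>
  have J_le: "card J \<le> weight J (C @ I)"
  proof (cases "C @ I = [] \<and> n = 0")
    case True
    then show ?thesis using J by simp
  next
    case False
    have "C @ I \<noteq> []"
    proof
      assume E: "C @ I = []"
      then have "lattice_coatoms (inclusion_order P) = {}" using C by auto
      with coatom_exists False E show False by auto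
    qed
    then obtain A where A: "A \<in> set (C @ I)" by (metis hd_in_set)
    have "card J \<le> card (A \<union> J)" using fin fJ A by (intro card_mono) auto
    also have "\<dots> \<le> weight J (C @ I)" by (rule card_mem_le_weight[OF A])
    finally show ?thesis .
  qed
  have "s \<le> (11 * r + 2) * weight J (C @ I)"
  proof (rule face_iterator_memory[OF run fJ fin order_refl J_le Int_closed _ CP])
    show "\<not> x \<subset> y" if "x \<in> set C" "y \<in> set C" for x y
      using that unfolding C by (auto simp: coatoms_inclusion_order)
    show "chain_rank P x < chain_rank P y" if "x \<in> P" "y \<in> P" "x \<subset> y" for x y
      using chain_rank_strict_mono[OF finite_lattice] that by blast
    \<comment> \<open>The top element has height at most \<open>r\<close>, and a coatom lies
      strictly below it.\<close>
    show "chain_rank P c < r" if "c \<in> set C" for c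
    proof -
      let ?t = "\<top>\<^bsub>inclusion_order P\<^esub>"
      have "c \<in> P" "c \<subset> ?t" using that C by (auto simp: coatoms_inclusion_order)
      then have "chain_rank P c < chain_rank P ?t"
        by (rule chain_rank_strict_mono[OF finite_lattice])
      moreover have "chain_rank P ?t < r + 1"
        unfolding r by (rule chain_rank_less_Max[OF finite_lattice top(1)])
      ultimately show ?thesis by simp
    qed
  qed
  also have "\<dots> \<le> 13 * (weight J (C @ I) * r)"
  \<comment> \<open>For positive \<open>n\<close> the length \<open>r\<close> is at least 1 and
    absorbs the additive 2. For \<open>n = 0\<close> every set involved is empty, so the weight is
    0.\<close>
  proof (cases "n = 0")
    case True
    have "card (A \<union> J) = 0" if "A \<in> set (C @ I)" for A
      using that CP PB I J True by auto
    then have "weight J (C @ I) = 0" unfolding weight_def by (simp add: sum_list_0)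
    then show ?thesis by simp
  next
    case False
    then have "1 \<le> r" using longest_chain_ge_2 r by simp
    then have "(11 * r + 2) * weight J (C @ I) \<le> (13 * r) * weight J (C @ I)"
      by (intro mult_right_mono) auto
    then show ?thesis by (simp add: mult_ac)
  qed
  finally show ?thesis .
qed

end

text \<open>One constant \<open>B\<close>, depending only on \<open>K\<close> and \<open>e\<close>,
  serves all inputs, executions and admissible costs. The proviso on the runtime is there because
  every run performs at least one \<open>Test_Empty\<close>: with a positive overhead this may cost
  \<open>e\<close>, while the claimed bound is 0 when \<open>\<alpha> * m\<close> is 0.\<close>

theorem theorem4p1:
  fixes K e :: real
  assumes "0 \<le> K" and "0 \<le> e"
  shows "\<exists>B::real. \<forall>(n::nat) (P :: nat set set) (I :: nat set list) (J :: nat set)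
           (C :: nat set list) (r::nat) (m::nat) (\<alpha>::nat) (\<phi>::nat)
           (ops :: operation list) (s::nat) (cost :: operation \<Rightarrow> real).
         meet_semisublattice_of_boolean n P \<longrightarrow>
         locally_branched (inclusion_order P) \<longrightarrow>
         set I \<subseteq> Pow {1..n} \<longrightarrow>
         J \<subseteq> {1..n} \<longrightarrow>
         distinct C \<longrightarrow>
         set C = {c \<in> lattice_coatoms (inclusion_order P). \<forall>y\<in>set I. \<not> c \<subseteq> y} \<longrightarrow>
         r + 1 = Max (card ` {X. subset.chain P X}) \<longrightarrow>
         m = length C \<longrightarrow>
         \<alpha> = (\<Sum>a\<leftarrow>C @ I. card (a \<union> J)) \<longrightarrow>
         face_iterator C I J ops s \<longrightarrow>
         \<phi> = recursive_calls ops \<longrightarrow>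
         admissible_cost K e cost \<longrightarrow>
           real s \<le> B * real (\<alpha> * r) \<and>
           (e = 0 \<or> 0 < \<alpha> * m \<longrightarrow> runtime cost ops \<le> B * real (\<alpha> * m * \<phi>))"
\<comment> \<open>13 comes from the memory bound, \<open>8 * K\<close> from the size-dependent work,
  and \<open>11 * e\<close> from the number of operations.\<close>
proof (rule exI[of _ "13 + 8 * K + 11 * e"], intro allI impI)
  fix n P I J C r m \<alpha> \<phi> ops s and cost :: "operation \<Rightarrow> real"
  let ?B = "13 + 8 * K + 11 * e"
  assume P: "meet_semisublattice_of_boolean n P"
    and I: "set I \<subseteq> Pow {1..n}" and J: "J \<subseteq> {1..n}"
    and C: "set C = {c \<in> lattice_coatoms (inclusion_order P). \<forall>y\<in>set I. \<not> c \<subseteq> y}"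
    and r: "r + 1 = Max (card ` {X. subset.chain P X})"
    and m: "m = length C" and \<alpha>: "\<alpha> = (\<Sum>a\<leftarrow>C @ I. card (a \<union> J))"
    and run: "face_iterator C I J ops s" and \<phi>: "\<phi> = recursive_calls ops"
    and cost: "admissible_cost K e cost"
  have w: "weight J (C @ I) = \<alpha>" by (simp only: \<alpha> weight_def)
  have "s \<le> 13 * (\<alpha> * r)"
    using coatoms_memory[OF P I J C r run] by (simp only: w)
  then have "real s \<le> 13 * real (\<alpha> * r)" by linarith
  also have "\<dots> \<le> ?B * real (\<alpha> * r)" using assms by (intro mult_right_mono) auto
  finally have memory: "real s \<le> ?B * real (\<alpha> * r)" .
  have "set C \<subseteq> Pow {1..n}"
    using C P by (auto simp: coatoms_inclusion_order meet_semisublattice_of_boolean_def)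
  with I J have "J \<subseteq> {1..n}" "\<And>A. A \<in> set C \<union> set I \<Longrightarrow> A \<subseteq> {1..n}" by auto
  then have fin: "finite J" "\<And>A. A \<in> set C \<union> set I \<Longrightarrow> finite A"
    by (meson finite_atLeastAtMost finite_subset)+
  have work: "(\<Sum>p\<leftarrow>ops. cost_order p) \<le> 8 * (\<alpha> * m * \<phi>)"
    and len: "length ops \<le> 10 * (m * \<phi>) + 1" and pos: "C \<noteq> [] \<longrightarrow> 0 < \<phi>"
    using face_iterator_work[OF run fin(1) _ order_refl order_refl] fin(2)
    unfolding m w \<phi> by blast+
  \<comment> \<open>With \<open>\<alpha>\<close>, \<open>m\<close> and \<open>\<phi>\<close>
    positive, the additive 1 in \<open>len\<close> is at most \<open>m * \<phi>\<close>, which turns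
    10 into 11.\<close>
  have ops: "e * real (length ops) \<le> e * (11 * real (\<alpha> * m * \<phi>))" if "e = 0 \<or> 0 < \<alpha> * m"
  proof (cases "e = 0")
    case False
    with that have "0 < \<alpha>" "0 < m" "0 < \<phi>" using pos m by auto
    then have "1 \<le> m * \<phi>" "m * \<phi> \<le> \<alpha> * m * \<phi>" by auto
    with len have "length ops \<le> 11 * (\<alpha> * m * \<phi>)" by linarith
    then have "real (length ops) \<le> 11 * real (\<alpha> * m * \<phi>)" by linarith
    then show ?thesis using assms(2) by (rule mult_left_mono)
  qed simp
  have "runtime cost ops \<le> ?B * real (\<alpha> * m * \<phi>)" if "e = 0 \<or> 0 < \<alpha> * m"
  proof -
    have "runtime cost ops \<le> K * real (\<Sum>p\<leftarrow>ops. cost_order p) + e * real (length ops)"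
      by (rule runtime_le[OF cost])
    also have "\<dots> \<le> K * (8 * real (\<alpha> * m * \<phi>)) + e * (11 * real (\<alpha> * m * \<phi>))"
      using work by (intro add_mono ops[OF that] mult_left_mono[OF _ assms(1)]) linarith
    also have "\<dots> = (8 * K + 11 * e) * real (\<alpha> * m * \<phi>)" by (simp add: distrib_right)
    also have "\<dots> \<le> ?B * real (\<alpha> * m * \<phi>)" by (rule mult_right_mono) auto
    finally show ?thesis .
  qed
  with memory show "real s \<le> ?B * real (\<alpha> * r) \<and>
      (e = 0 \<or> 0 < \<alpha> * m \<longrightarrow> runtime cost ops \<le> ?B * real (\<alpha> * m * \<phi>))"
    by blast
qed

end
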